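(* Let $G_H$ be a connected half-edge ribbon graph (HERG) and $G_H^*$ its dual. The following identities hold modulo the relation $b^2=ab$, i.e. in $\mathbb{Z}[a,a^{-1},b]/\langle b^2-ab\rangle$. (1) If $C_{\mathrm{ext}}(G_H)>0$, then $$\mathcal{R}_{G_H}(a+1,a,a^{-1},b,1,1)=\mathcal{R}_{G_H^*}(a+1,a,a^{-1},b,1,1).$$ (2) If $C_{\mathrm{ext}}(G_H)=0$, then $$a\,\mathcal{R}_{G_H}(a+1,a,a^{-1},b,1,1)-M_{G_H}(a,b)=a\,\mathcal{R}_{G_H^*}(a+1,a,a^{-1},b,1,1)-M_{G_H^*}(a,b).$$
   Context: HERGs. A ribbon graph $G(V,E)$ is a (not necessarily orientable) surface with boundary represented as the union of two sets of closed discs, vertices and edges, such that vertices and edges intersect in disjoint line segments, each such segment lies on the boundary of precisely one vertex and one edge, and each edge contains exactly two such segments. A HERG $G_H=G(V,E,H)$ is a ribbon graph with a set $H$ of half-ribbons (HRs): rectangles each attached to a unique vertex disc along one side $s$; the side parallel to $s$ is the external segment of the HR. The underlying half-edge graph (HEG) of $G_H$ is the graph with vertex set $V$, edge set $E$, half-edge set $H$ and the induced incidence relations. A closed face of a HERG is a boundary component meeting no external segment of an HR; an external cycle is a boundary component meeting external segments. $f_{\mathrm{int}}$ and $C_{\mathrm{ext}}$ denote the numbers of closed faces and external cycles. Cutting. The cut $G_H\vee e$ of an edge $e$ deletes $e$ and inserts two HRs, one at each of the two places where $e$ was attached to its end vertices (or vertex, for a loop). A spanning cutting subgraph $A\Subset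 G_H$ is a HERG obtained from $G_H$ by cutting all the edges of some subset of edges. $G_H\vee E(G_H)$ is obtained by cutting all edges. Polynomials. Put $$\mathcal{R}_{G_H}(x,y,z,s,w,t)=\sum_{A\Subset G_H}(x-1)^{r(G_H)-r(A)}y^{n(A)}z^{k(A)-f_{\mathrm{int}}(A)+n(A)}s^{C_{\mathrm{ext}}(A)}w^{o(A)}t^{|H(A)|},$$ the sum being over all spanning cutting subgraphs, where $k(A)$ is the number of connected components, $r(A)=|V(A)|-k(A)$ the rank, $n(A)=|E(A)|-r(A)$ the nullity, $o(A)=0$ if $A$ is orientable and $1$ otherwise, $|H(A)|$ the number of HRs of $A$, and $w^2=w$. Put $$M_{G_H}(a,b)=\sum_{A\in\{G_H\vee E(G_H),\,G_H\}}a^{f_{\mathrm{int}}(A)}b^{C_{\mathrm{ext}}(A)}.$$ The dual $G_H^*$. A HEG cellular embedding of a HEG $\mathcal{G}_H$ in a punctured surface $\Sigma$ (a closed connected surface $\widetilde\Sigma$ minus finitely many disjoint closed discs) is an embedding $\phi$ in $\Sigma\cup\partial\Sigma$ of the completed graph $\bar{\mathcal{G}}$ (obtained by turning each half-edge into an edge ending at a new vertex) such that $\widetilde\Sigma-\phi(\bar{\mathcal{G}})$ is a disjoint union of open discs and the image of $\bar{\mathcal{G}}$ meets $\partial\Sigma$ exactly in the new vertices. It is $h$-proper if the number of half-edges equals the number of punctures and every boundary circle meets $\bar{\mathcal{G}}$ (so exactly one half-edge ends on each boundary circle). The HERG of such an embedding is a small neighbourhood band of the embedded HEG, HRs being neighbourhoods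 of half-edges. Each connected HERG $G_H$ is the HERG of an $h$-proper HEG cellular embedding of its underlying HEG $\mathcal{G}_H$, unique up to homeomorphism. The geometric dual of an $h$-proper embedding is obtained as follows. Take the geometric dual $\bar{\mathcal{G}}^*$ of $\bar{\mathcal{G}}$ in $\Sigma$: one vertex in each component of $\Sigma-\phi(\bar{\mathcal{G}})$ and, for each edge of $\bar{\mathcal{G}}$, one dual edge crossing it transversally and joining the vertices on its two sides. The dual of each completed half-edge is then a loop, based at some vertex $v^*$, encircling the boundary circle $c$ on which the half-edge ends. Replace each such loop by a half-edge attached to $v^*$ at the place of the loop in the cyclic order around $v^*$ and ending on $c$. This is an $h$-proper HEG cellular embedding in $\Sigma$; its HERG is by definition the dual $G_H^*$ of $G_H$. *)

theory Defs
  imports "HOL-Library.Poly_Mapping" "HOL-Computational_Algebra.Polynomial"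
begin

text \<open>
  Ribbon graphs are surfaces; they are encoded, up to homeomorphism, by the flag (generalised map)
  encoding.  A flag is an end point of one of the line segments along which a ribbon
  (an edge disc or a half-ribbon) is attached to a vertex disc.  Three maps act on the flags:

  \<^item> \<open>seg\<close> leads to the other end of the same attaching segment;
  \<^item> \<open>arc\<close> leads along the free part of the boundary of the vertex disc to the next attaching
    segment (possibly the other end of the same one);
  \<^item> \<open>side\<close> leads along the free boundary of the ribbon to its other end.  For an edge this is a
    side joining the two attaching segments.  For a half-ribbon it is the path side, external
    segment, side, so that it leads to the other end of the same attaching segment.

  The boundary circle of a vertex disc alternates \<open>seg\<close> and \<open>arc\<close>; a boundary component of the
  surface alternates \<open>side\<close> and \<open>arc\<close>.  Vertex discs with no ribbon attached carry no flag and are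
  listed in \<open>bare\<close>; the boundary of such a disc is a whole boundary component.
\<close>

record ('p, 'v) herg =
  flags :: "'p set"
  seg :: "'p \<Rightarrow> 'p"
  arc :: "'p \<Rightarrow> 'p"
  side :: "'p \<Rightarrow> 'p"
  bare :: "'v set"

definition free_involution_on :: "'p set \<Rightarrow> ('p \<Rightarrow> 'p) \<Rightarrow> bool" where
  "free_involution_on P f \<longleftrightarrow> (\<forall>p\<in>P. f p \<in> P \<and> f p \<noteq> p \<and> f (f p) = p)"

text \<open>An edge disc has four flags, a half-ribbon has two; commutation of \<open>seg\<close> and \<open>side\<close> says that
  there is no other kind of ribbon.\<close>

definition is_herg :: "('p, 'v) herg \<Rightarrow> bool" where
  "is_herg G \<longleftrightarrow>
     finite (flags G) \<and> finite (bare G) \<and>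
     free_involution_on (flags G) (seg G) \<and>
     free_involution_on (flags G) (arc G) \<and>
     free_involution_on (flags G) (side G) \<and>
     (\<forall>p\<in>flags G. seg G (side G p) = side G (seg G p))"

definition hr_flags :: "('p, 'v) herg \<Rightarrow> 'p set" where
  "hr_flags G = {p \<in> flags G. side G p = seg G p}"

definition half_ribbons :: "('p, 'v) herg \<Rightarrow> 'p set set" where
  "half_ribbons G = {{p, seg G p} | p. p \<in> hr_flags G}"

definition edges :: "('p, 'v) herg \<Rightarrow> 'p set set" where
  "edges G = {{p, seg G p, side G p, seg G (side G p)} | p. p \<in> flags G - hr_flags G}"

text \<open>Orbits; for involutions the closure below is an equivalence relation.\<close>

definition orbits :: "'p set \<Rightarrow> ('p \<Rightarrow> 'p) set \<Rightarrow> 'p set set" where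
  "orbits P F = P // ({(p, f p) | p f. p \<in> P \<and> f \<in> F}\<^sup>*)"

definition vertices :: "('p, 'v) herg \<Rightarrow> ('p set + 'v) set" where
  "vertices G = orbits (flags G) {seg G, arc G} <+> bare G"

definition components :: "('p, 'v) herg \<Rightarrow> ('p set + 'v) set" where
  "components G = orbits (flags G) {seg G, arc G, side G} <+> bare G"

definition closed_faces :: "('p, 'v) herg \<Rightarrow> ('p set + 'v) set" where
  "closed_faces G = {B \<in> orbits (flags G) {side G, arc G}. B \<inter> hr_flags G = {}} <+> bare G"

definition external_cycles :: "('p, 'v) herg \<Rightarrow> 'p set set" where
  "external_cycles G = {B \<in> orbits (flags G) {side G, arc G}. B \<inter> hr_flags G \<noteq> {}}"

text \<open>Orienting all discs compatibly amounts to calling each flag the start or the end of its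
  attaching segment, such that each of the three maps exchanges starts and ends.\<close>

definition orientable :: "('p, 'v) herg \<Rightarrow> bool" where
  "orientable G \<longleftrightarrow> (\<exists>c :: 'p \<Rightarrow> bool. \<forall>p\<in>flags G.
     c (seg G p) \<noteq> c p \<and> c (arc G p) \<noteq> c p \<and> c (side G p) \<noteq> c p)"

definition num_components :: "('p, 'v) herg \<Rightarrow> nat" where
  "num_components G = card (components G)"

definition rank :: "('p, 'v) herg \<Rightarrow> nat" where
  "rank G = card (vertices G) - num_components G"

definition nullity :: "('p, 'v) herg \<Rightarrow> nat" where
  "nullity G = card (edges G) - rank G"

definition f_int :: "('p, 'v) herg \<Rightarrow> nat" where
  "f_int G = card (closed_faces G)"

definition C_ext :: "('p, 'v) herg \<Rightarrow> nat" where
  "C_ext G = card (external_cycles G)"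

definition non_orientability :: "('p, 'v) herg \<Rightarrow> nat" where
  "non_orientability G = (if orientable G then 0 else 1)"

definition herg_connected :: "('p, 'v) herg \<Rightarrow> bool" where
  "herg_connected G \<longleftrightarrow> num_components G = 1"

text \<open>Cutting the edges in \<open>X\<close>: the attaching segments stay, and each of them now carries a
  half-ribbon of its own.\<close>

definition cut :: "('p, 'v) herg \<Rightarrow> 'p set set \<Rightarrow> ('p, 'v) herg" where
  "cut G X = G\<lparr>side := (\<lambda>p. if p \<in> \<Union>X then seg G p else side G p)\<rparr>"

definition spanning_cutting_subgraphs :: "('p, 'v) herg \<Rightarrow> ('p, 'v) herg set" where
  "spanning_cutting_subgraphs G = {cut G X | X. X \<subseteq> edges G}"

text \<open>The polynomial \<open>\<R>\<close> as a polynomial function on commutative rings.  None of the natural number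
  subtractions truncates for a HERG: cutting cannot decrease the number of components, and
  \<open>num_components A + nullity A\<close> exceeds the number of all boundary components by the Euler genus
  of \<open>A\<close>.  The exponent of \<open>w\<close> is 0 or 1, so the relation \<open>w\<^sup>2 = w\<close> plays no role in the formula.\<close>

definition R_poly ::
    "('p, 'v) herg \<Rightarrow> 'r \<Rightarrow> 'r \<Rightarrow> 'r \<Rightarrow> 'r \<Rightarrow> 'r \<Rightarrow> 'r \<Rightarrow> 'r::comm_ring_1" where
  "R_poly G x y z s w t =
     (\<Sum>A\<in>spanning_cutting_subgraphs G.
        (x - 1) ^ (rank G - rank A) * y ^ nullity A
        * z ^ (num_components A + nullity A - f_int A)
        * s ^ C_ext A * w ^ non_orientability A * t ^ card (half_ribbons A))"

definition M_poly :: "('p, 'v) herg \<Rightarrow> 'r \<Rightarrow> 'r \<Rightarrow> 'r::comm_ring_1" where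
  "M_poly G a b = (\<Sum>A\<in>{cut G (edges G), G}. a ^ f_int A * b ^ C_ext A)"

text \<open>The dual.  A HERG determines the embedding of its underlying half-edge graph with one puncture
  per half-edge, and the faces of the embedding are bounded by the boundary components of the HERG.

  The completed graph: a half-ribbon with flags \<open>p\<close>, \<open>q\<close> becomes an edge disc by gluing a new vertex
  disc to its external segment, whose end next to \<open>p\<close> is the flag \<open>(p, True)\<close>.  The new vertex
  disc has only this one attaching segment, so its \<open>arc\<close> and \<open>seg\<close> agree.\<close>

definition completion :: "('p, 'v) herg \<Rightarrow> ('p \<times> bool, 'v) herg" where
  "completion G =
     \<lparr>flags = flags G \<times> {False} \<union> hr_flags G \<times> {True},
      seg = (\<lambda>(p, i). (seg G p, i)),
      arc = (\<lambda>(p, i). (if i then seg G p else arc G p, i)),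
      side = (\<lambda>(p, i). if p \<in> hr_flags G then (p, \<not> i) else (side G p, i)),
      bare = bare G\<rparr>"

text \<open>Geometric dual of a cellularly embedded graph: the vertex discs of the dual are glued along the
  boundary components, and each edge disc is attached to them along the two sides by which it was
  not attached before.  A single bare vertex disc lies in a sphere and its dual is again a bare
  disc.\<close>

definition geometric_dual :: "('p, 'v) herg \<Rightarrow> ('p, 'v) herg" where
  "geometric_dual G = G\<lparr>seg := side G, side := seg G\<rparr>"

text \<open>In the geometric dual \<open>D\<close> of the completed graph, the dual of a half-edge with flags \<open>p\<close>, \<open>q\<close> is
  a loop.  Its two attaching segments have the ends \<open>(p, False)\<close>, \<open>(p, True)\<close> and
  \<open>(q, True)\<close>, \<open>(q, False)\<close>, and the arc between \<open>(p, True)\<close> and \<open>(q, True)\<close> bounds the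
  punctured face inside the loop.  Replacing the loop by a half-edge merges these two segments and
  the arc between them into one attaching segment, with ends \<open>(p, False)\<close> and \<open>(q, False)\<close>, which
  carries the new half-ribbon.  The flags \<open>(p, False)\<close> are finally renamed to \<open>p\<close>.\<close>

definition dual :: "('p, 'v) herg \<Rightarrow> ('p, 'v) herg" where
  "dual G =
     (let D = geometric_dual (completion G);
          merged = (\<lambda>p. fst (seg D (arc D (seg D (p, False)))))
      in \<lparr>flags = {p. (p, False) \<in> flags D},
          seg = (\<lambda>p. if p \<in> hr_flags G then merged p else fst (seg D (p, False))),
          arc = (\<lambda>p. fst (arc D (p, False))),
          side = (\<lambda>p. if p \<in> hr_flags G then merged p else fst (side D (p, False))),
          bare = bare D\<rparr>)"

lemma is_herg_cut:
  assumes "is_herg G" "X \<subseteq> edges G"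
  shows "is_herg (cut G X)"
proof -
  have closed: "seg G p \<in> \<Union>X \<and> side G p \<in> \<Union>X" if "p \<in> \<Union>X" for p
  proof -
    from that obtain e where e: "e \<in> X" "p \<in> e" by blast
    then obtain q where q: "q \<in> flags G" "e = {q, seg G q, side G q, seg G (side G q)}"
      using assms(2) unfolding edges_def by blast
    then have "seg G p \<in> e \<and> side G p \<in> e"
      using assms(1) e(2) unfolding is_herg_def free_involution_on_def by auto
    with e(1) show ?thesis by blast
  qed
  have "seg G p \<in> \<Union>X \<longleftrightarrow> p \<in> \<Union>X" "side G p \<in> \<Union>X \<longleftrightarrow> p \<in> \<Union>X" if "p \<in> flags G" for p
    using closed[of p] closed[of "seg G p"] closed[of "side G p"] that assms(1)
    unfolding is_herg_def free_involution_on_def by metis+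
  with assms(1) show ?thesis
    unfolding is_herg_def free_involution_on_def cut_def by (simp del: Union_iff)
qed

lemma is_herg_dual:
  assumes "is_herg G"
  shows "is_herg (dual G)"
proof -
  have "seg G p \<in> hr_flags G \<longleftrightarrow> p \<in> hr_flags G" "side G p \<in> hr_flags G \<longleftrightarrow> p \<in> hr_flags G"
    if "p \<in> flags G" for p
    using that assms unfolding is_herg_def free_involution_on_def hr_flags_def by (auto, metis+)
  moreover have "flags (dual G) = flags G"
    by (auto simp: dual_def Let_def geometric_dual_def completion_def)
  ultimately show ?thesis
    using assms unfolding is_herg_def free_involution_on_def
    by (auto simp: dual_def Let_def geometric_dual_def completion_def)
qed

text \<open>The ring \<open>\<int>[a, a\<^sup>-\<^sup>1, b]\<close>: polynomials in \<open>b\<close> over the ring of Laurent polynomials in \<open>a\<close>,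
  which is the group ring of the integers.\<close>

type_synonym coeff_ring = "(int \<Rightarrow>\<^sub>0 int) poly"

definition var_a :: coeff_ring where
  "var_a = [:Poly_Mapping.single 1 1:]"

definition var_a_inv :: coeff_ring where
  "var_a_inv = [:Poly_Mapping.single (- 1) 1:]"

definition var_b :: coeff_ring where
  "var_b = [:0, 1:]"

lemma var_a_inv: "var_a * var_a_inv = 1"
  by (simp add: var_a_def var_a_inv_def Poly_Mapping.mult_single one_pCons)

definition eq_mod :: "coeff_ring \<Rightarrow> coeff_ring \<Rightarrow> bool" where
  "eq_mod u v \<longleftrightarrow> var_b\<^sup>2 - var_a * var_b dvd u - v"

end

theory Submission
  imports Defs
begin

text \<open>
  In the flag encoding the dual exchanges \<open>seg\<close> and \<open>side\<close>.  After the substitution the exponents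
  of the summand of \<open>A\<close> in \<open>a * \<R>\<close> telescope to \<open>a ^ f_int A * b ^ C_ext A\<close>, and modulo \<open>b\<^sup>2 = a b\<close>
  this depends only on the total number of boundary components as soon as \<open>C_ext A > 0\<close>.  Cutting the
  edges \<open>X\<close> of \<open>G\<close> and cutting the complementary edges of the dual give the same boundary components,
  so complementation matches the two sums term by term; the exceptional subsets \<open>{}\<close> and
  \<open>edges G\<close>, where \<open>C_ext\<close> may vanish on one side only, are the ones subtracted by \<open>M_poly\<close>.

  The exponent of \<open>a\<^sup>-\<^sup>1\<close> is a truncated difference, so the telescoping needs that the Euler genus is
  nonnegative.  This is shown by cutting the edges one at a time: the number of boundary components
  drops by at most one, and it grows by one when the edge is a bridge.
\<close>

section \<open>Joining classes of an equivalence relation\<close>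

text \<open>The link is added in both directions, so that a symmetric relation stays symmetric and
  its closure remains an equivalence.\<close>

definition join :: "'a \<Rightarrow> 'a \<Rightarrow> ('a \<times> 'a) set \<Rightarrow> ('a \<times> 'a) set" where
  "join p q r = insert (p, q) (insert (q, p) r)"

lemma sym_join: "sym r \<Longrightarrow> sym (join p q r)"
  by (auto simp: join_def sym_def)

text \<open>A path that crosses the new link several times has a shortcut that crosses it at most
  once: the stretch between two crossings can be skipped.\<close>

lemma rtrancl_join:
  "(x, y) \<in> (join p q r)\<^sup>* \<longleftrightarrow>
     (x, y) \<in> r\<^sup>* \<or> (x, p) \<in> r\<^sup>* \<and> (q, y) \<in> r\<^sup>* \<or> (x, q) \<in> r\<^sup>* \<and> (p, y) \<in> r\<^sup>*"
  unfolding join_def rtrancl_insert by (auto intro: rtrancl_trans)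

lemma Image_rtrancl_eq_iff:
  assumes "sym r"
  shows "r\<^sup>* `` {x} = r\<^sup>* `` {y} \<longleftrightarrow> (x, y) \<in> r\<^sup>*"
proof -
  have "equiv UNIV (r\<^sup>*)"
    using assms by (intro equivI) (auto simp: refl_rtrancl sym_rtrancl trans_rtrancl)
  from eq_equiv_class_iff[OF this, of x y] show ?thesis by simp
qed

text \<open>Only the classes \<open>C\<close> of \<open>p\<close> and \<open>D\<close> of
  \<open>q\<close> are affected; if they differ, their union takes the place of both.\<close>

lemma card_quotient_join:
  assumes "sym r" "finite P" "p \<in> P" "q \<in> P"
  shows "card (P // r\<^sup>*) = card (P // (join p q r)\<^sup>*) + (if (p, q) \<in> r\<^sup>* then 0 else 1)"
proof (cases "(p, q) \<in> r\<^sup>*")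
  case True
  with assms(1) have "(q, p) \<in> r\<^sup>*"
    by (meson sym_rtrancl symD)
  with True have "(join p q r)\<^sup>* = r\<^sup>*"
    by (auto simp: rtrancl_join intro: rtrancl_trans)
  with True show ?thesis by simp
next
  case False
  have symD': "(y, x) \<in> r\<^sup>*" if "(x, y) \<in> r\<^sup>*" for x y
    using that assms(1) by (meson sym_rtrancl symD)
  define C where "C = r\<^sup>* `` {p}"
  define D where "D = r\<^sup>* `` {q}"
  have cls: "(join p q r)\<^sup>* `` {x} = (if x \<in> C \<union> D then C \<union> D else r\<^sup>* `` {x})" for x
  proof (rule set_eqI)
    fix y
    have "(x, y) \<in> (join p q r)\<^sup>* \<longleftrightarrow>
        (if (p, x) \<in> r\<^sup>* \<or> (q, x) \<in> r\<^sup>* then (p, y) \<in> r\<^sup>* \<or> (q, y) \<in> r\<^sup>* else (x, y) \<in> r\<^sup>*)"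
    proof -
      have R: "(u, y) \<in> r\<^sup>* \<longleftrightarrow> (v, y) \<in> r\<^sup>*" if "(u, v) \<in> r\<^sup>*" for u v
        using that symD'[OF that] by (blast intro: rtrancl_trans)
      consider "(p, x) \<in> r\<^sup>*" | "(q, x) \<in> r\<^sup>*" | "(p, x) \<notin> r\<^sup>*" "(q, x) \<notin> r\<^sup>*" by blast
      then show ?thesis
      proof cases
        case 1
        then show ?thesis using R[OF 1] symD'[OF 1] unfolding rtrancl_join by simp blast
      next
        case 2
        then show ?thesis using R[OF 2] symD'[OF 2] unfolding rtrancl_join by simp blast
      next
        case 3
        then have "(x, p) \<notin> r\<^sup>*" "(x, q) \<notin> r\<^sup>*" using symD' by blast+
        with 3 show ?thesis unfolding rtrancl_join by simp
      qed
    qed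
    then show "y \<in> (join p q r)\<^sup>* `` {x} \<longleftrightarrow> y \<in> (if x \<in> C \<union> D then C \<union> D else r\<^sup>* `` {x})"
      by (simp add: C_def D_def)
  qed
  have CD: "C \<in> P // r\<^sup>*" "D \<in> P // r\<^sup>*" "C \<noteq> D"
    using assms False Image_rtrancl_eq_iff[OF assms(1), of p q]
    by (auto simp: C_def D_def quotient_def)
  have eqC: "r\<^sup>* `` {x} = C \<longleftrightarrow> x \<in> C" "r\<^sup>* `` {x} = D \<longleftrightarrow> x \<in> D" for x
    using Image_rtrancl_eq_iff[OF assms(1)] symD' unfolding C_def D_def by auto
  have "P // (join p q r)\<^sup>* = insert (C \<union> D) (P // r\<^sup>* - {C, D})"
  proof (intro equalityI subsetI)
    fix Y assume "Y \<in> P // (join p q r)\<^sup>*"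
    then show "Y \<in> insert (C \<union> D) (P // r\<^sup>* - {C, D})"
      by (auto simp: quotient_def cls eqC split: if_splits)
  next
    fix Y assume Y: "Y \<in> insert (C \<union> D) (P // r\<^sup>* - {C, D})"
    show "Y \<in> P // (join p q r)\<^sup>*"
    proof (cases "Y = C \<union> D")
      case True
      have "p \<in> C" by (simp add: C_def)
      with True have "Y = (join p q r)\<^sup>* `` {p}" by (simp add: cls)
      with assms show ?thesis by (auto simp: quotient_def)
    next
      case False
      with Y obtain x where "x \<in> P" "Y = r\<^sup>* `` {x}" "Y \<noteq> C" "Y \<noteq> D"
        by (auto simp: quotient_def)
      then have "Y = (join p q r)\<^sup>* `` {x}" by (auto simp: cls eqC)
      with \<open>x \<in> P\<close> show ?thesis by (auto simp: quotient_def)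
    qed
  qed
  \<comment> \<open>An old class that equals the union and is not \<open>C\<close> would have to be
    \<open>D\<close>, and would then contain \<open>p\<close>.\<close>
  moreover have "C \<union> D \<notin> P // r\<^sup>* - {C, D}"
  proof
    assume "C \<union> D \<in> P // r\<^sup>* - {C, D}"
    then obtain x where x: "r\<^sup>* `` {x} = C \<union> D" "C \<union> D \<noteq> C" by (auto simp: quotient_def)
    then have "x \<in> C \<union> D" by blast
    with x eqC[of x] CD(1) have "C \<union> D = D" by auto
    then have "p \<in> D" by (auto simp: C_def)
    then show False using False symD' by (auto simp: D_def)
  qed
  moreover have fin: "finite (P // r\<^sup>*)"
    using assms(2) by (auto simp: quotient_def)
  moreover have "card (P // r\<^sup>*) = card (P // r\<^sup>* - {C, D}) + 2"
  proof -
    have "card {C, D} \<le> card (P // r\<^sup>*)" by (rule card_mono) (use CD fin in auto)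
    then show ?thesis using CD by (simp add: card_Diff_subset)
  qed
  ultimately show ?thesis using False by simp
qed

text \<open>Saturating with the coarser closure maps the fine classes onto the coarse ones.\<close>

lemma card_quotient_antimono:
  assumes "r \<subseteq> s" "sym s" "finite P"
  shows "card (P // s\<^sup>*) \<le> card (P // r\<^sup>*)"
proof -
  have sub: "r\<^sup>* \<subseteq> s\<^sup>*" using assms(1) by (rule rtrancl_mono)
  have "s\<^sup>* `` (r\<^sup>* `` {x}) = s\<^sup>* `` {x}" for x
    using sub by (auto intro: rtrancl_trans)
  then have "P // s\<^sup>* = (\<lambda>C. s\<^sup>* `` C) ` (P // r\<^sup>*)"
    by (auto simp: quotient_def)
  moreover have "finite (P // r\<^sup>*)"
    using assms(3) by (auto simp: quotient_def)
  ultimately show ?thesis by (simp add: card_image_le)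
qed

text \<open>Cutting an edge with flags \<open>p\<close>, \<open>p'\<close>, \<open>q\<close>, \<open>q'\<close> recouples \<open>p q | p' q'\<close> to \<open>p p' | q q'\<close>.\<close>

lemma card_quotient_recouple_le:
  assumes "sym r" "finite P" "{p, q, p', q'} \<subseteq> P"
  shows "card (P // (join p q (join p' q' r))\<^sup>*) \<le> card (P // (join p p' (join q q' r))\<^sup>*) + 1"
proof -
  have symD': "(y, x) \<in> r\<^sup>*" if "(x, y) \<in> r\<^sup>*" for x y
    using that assms(1) by (meson sym_rtrancl symD)
  have ends: "p \<in> P" "q \<in> P" "p' \<in> P" "q' \<in> P" using assms(3) by auto
  note J1 = card_quotient_join[OF assms(1,2) ends(3,4)]
  note J2 = card_quotient_join[OF assms(1,2) ends(2,4)]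
  note J3 = card_quotient_join[OF sym_join[OF assms(1), of p' q'] assms(2) ends(1,2)]
  note J4 = card_quotient_join[OF sym_join[OF assms(1), of q q'] assms(2) ends(1,3)]
  have le_1: "(if b then 0 else 1) \<le> (1 :: nat)" for b by simp
  show ?thesis
  proof (cases "(p', q') \<in> r\<^sup>* \<and> (p, q) \<in> (join p' q' r)\<^sup>*")
    \<comment> \<open>The old coupling merges nothing here. Then \<open>p\<close>, \<open>q\<close>
      and \<open>p'\<close>, \<open>q'\<close> are already linked, so after joining \<open>q\<close>
      to \<open>q'\<close> the link from \<open>p\<close> to \<open>p'\<close> is redundant: the new
      coupling merges at most once. In the other case the old one merges at least once and the new
      one at most twice.\<close>
    case True
    then have "(p, q) \<in> r\<^sup>*"
      unfolding rtrancl_join by (metis rtrancl_trans symD')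
    with True have "(p, p') \<in> (join q q' r)\<^sup>*"
      unfolding rtrancl_join using symD' by blast
    then have "card (P // r\<^sup>*) \<le> card (P // (join p p' (join q q' r))\<^sup>*) + 1"
      using J2 J4 le_1[of "(q, q') \<in> r\<^sup>*"] by simp
    with J1 J3 show ?thesis by linarith
  next
    case False
    then have "card (P // (join p q (join p' q' r))\<^sup>*) + 1 \<le> card (P // r\<^sup>*)"
      using J1 J3 by (cases "(p', q') \<in> r\<^sup>*") simp_all
    moreover have "card (P // r\<^sup>*) \<le> card (P // (join p p' (join q q' r))\<^sup>*) + 2"
      using J2 J4 le_1[of "(q, q') \<in> r\<^sup>*"] le_1[of "(p, p') \<in> (join q q' r)\<^sup>*"] by linarith
    ultimately show ?thesis by linarith
  qed
qed

text \<open>The situation of a bridge: the new coupling links flags that are already linked, whereas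
  the old one performs a merge.\<close>

lemma card_quotient_recouple_less:
  assumes "sym r" "finite P" "{p, q, p', q'} \<subseteq> P"
    and "(p, p') \<in> r\<^sup>*" "(q, q') \<in> r\<^sup>*" "(p, q) \<notin> r\<^sup>*"
  shows "card (P // (join p q (join p' q' r))\<^sup>*) < card (P // (join p p' (join q q' r))\<^sup>*)"
proof -
  have symD': "(y, x) \<in> r\<^sup>*" if "(x, y) \<in> r\<^sup>*" for x y
    using that assms(1) by (meson sym_rtrancl symD)
  have ends: "p \<in> P" "q \<in> P" "p' \<in> P" "q' \<in> P" using assms(3) by auto
  have "(p', q') \<notin> r\<^sup>*"
    using assms(4-6) symD' by (meson rtrancl_trans)
  then have "card (P // r\<^sup>*) = card (P // (join p' q' r)\<^sup>*) + 1"
    using card_quotient_join[OF assms(1,2) ends(3,4)] by simp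
  moreover have "card (P // r\<^sup>*) = card (P // (join q q' r)\<^sup>*)"
    using card_quotient_join[OF assms(1,2) ends(2,4)] assms(5) by simp
  moreover have "(p, p') \<in> (join q q' r)\<^sup>*"
    using assms(4) by (simp add: rtrancl_join)
  then have "card (P // (join q q' r)\<^sup>*) = card (P // (join p p' (join q q' r))\<^sup>*)"
    using card_quotient_join[OF sym_join[OF assms(1), of q q'] assms(2) ends(1,3)] by simp
  moreover have "card (P // (join p q (join p' q' r))\<^sup>*) \<le> card (P // (join p' q' r)\<^sup>*)"
    using card_quotient_join[OF sym_join[OF assms(1), of p' q'] assms(2) ends(1,2)] by linarith
  ultimately show ?thesis by linarith
qed

text \<open>Removing a pair \<open>{x, f x}\<close> leaves a smaller set on which \<open>f\<close>
  is still a free involution. This supplies the parity argument for bridges.\<close>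

lemma even_card_free_involution:
  assumes "finite C" "free_involution_on C f"
  shows "even (card C)"
  using assms
proof (induction C rule: finite_psubset_induct)
  case (psubset C)
  show ?case
  proof (cases "C = {}")
    case False
    then obtain x where x: "x \<in> C" by blast
    let ?D = "C - {x, f x}"
    have f: "f y \<in> C" "f y \<noteq> y" "f (f y) = y" if "y \<in> C" for y
      using that psubset.prems by (simp_all add: free_involution_on_def)
    have "f y \<notin> {x, f x}" if "y \<in> ?D" for y
    proof
      assume "f y \<in> {x, f x}"
      then have "f (f y) \<in> {f x, f (f x)}" by auto
      then show False using that f x by auto
    qed
    then have "free_involution_on ?D f"
      unfolding free_involution_on_def using f by blast
    moreover have "?D \<subset> C" using x by blast
    ultimately have "even (card ?D)" using psubset.IH by blast
    moreover have "card C = card ?D + 2"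
    proof -
      have "{x, f x} \<subseteq> C" "x \<noteq> f x"
        using f[OF x] x by auto
      moreover from this have "card {x, f x} \<le> card C"
        using psubset.hyps by (intro card_mono)
      ultimately show ?thesis by (simp add: card_Diff_subset)
    qed
    ultimately show ?thesis by simp
  qed simp
qed

section \<open>Boundary components under cutting\<close>

text \<open>Names the relation whose closure is hidden in \<open>orbits\<close>, so that the
  quotient lemmas above apply to it.\<close>

definition flag_rel :: "'p set \<Rightarrow> ('p \<Rightarrow> 'p) set \<Rightarrow> ('p \<times> 'p) set" where
  "flag_rel P F = {(p, f p) | p f. p \<in> P \<and> f \<in> F}"

lemma flag_rel_eq_Sigma: "flag_rel P F = (SIGMA p:P. (\<lambda>f. f p) ` F)"
  by (auto simp: flag_rel_def)

lemma orbits_flag_rel: "orbits P F = P // (flag_rel P F)\<^sup>*"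
  by (simp add: orbits_def flag_rel_def)

lemma sym_flag_rel:
  assumes "\<And>f. f \<in> F \<Longrightarrow> free_involution_on P f"
  shows "sym (flag_rel P F)"
proof (rule symI)
  fix x y assume "(x, y) \<in> flag_rel P F"
  then obtain f where f: "f \<in> F" "x \<in> P" "y = f x" by (auto simp: flag_rel_def)
  with assms[OF f(1)] have "y \<in> P" "x = f y" by (auto simp: free_involution_on_def)
  with f(1) show "(y, x) \<in> flag_rel P F" by (auto simp: flag_rel_def)
qed

lemma orbits_cong:
  assumes "\<And>p. p \<in> P \<Longrightarrow> (\<lambda>f. f p) ` F = (\<lambda>f. f p) ` F'"
  shows "orbits P F = orbits P F'"
  using assms by (simp add: orbits_flag_rel flag_rel_eq_Sigma cong: Sigma_cong)

lemma finite_orbits: "finite P \<Longrightarrow> finite (orbits P F)"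
  by (simp add: orbits_def quotient_def)

text \<open>Only components that carry flags are listed; the boundary circles of bare discs are
  counted separately by \<open>card (bare G)\<close>.\<close>

definition boundary :: "('p, 'v) herg \<Rightarrow> 'p set set" where
  "boundary G = orbits (flags G) {side G, arc G}"

lemma cut_simps [simp]:
  "flags (cut G X) = flags G" "seg (cut G X) = seg G" "arc (cut G X) = arc G"
  "bare (cut G X) = bare G"
  "side (cut G X) p = (if p \<in> \<Union>X then seg G p else side G p)"
  by (simp_all add: cut_def)

section \<open>Edges and cut subgraphs in terms of flags\<close>

locale half_edge_ribbon_graph =
  fixes G :: "('p, 'v) herg"
  assumes herg: "is_herg G"
begin

lemma finite_flags: "finite (flags G)" and finite_bare: "finite (bare G)"
  using herg by (auto simp: is_herg_def)

lemma involution: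
  "free_involution_on (flags G) (seg G)"
  "free_involution_on (flags G) (arc G)"
  "free_involution_on (flags G) (side G)"
  using herg by (auto simp: is_herg_def)

lemma maps:
  assumes "p \<in> flags G"
  shows "seg G p \<in> flags G" "seg G p \<noteq> p" "seg G (seg G p) = p"
    "arc G p \<in> flags G" "arc G p \<noteq> p" "arc G (arc G p) = p"
    "side G p \<in> flags G" "side G p \<noteq> p" "side G (side G p) = p"
    "side G (seg G p) = seg G (side G p)"
  using herg assms unfolding is_herg_def free_involution_on_def by metis+

lemma finite_edges: "finite (edges G)"
  using finite_flags by (simp add: edges_def)

lemma edgeE:
  assumes "e \<in> edges G"
  obtains p where "p \<in> flags G" "side G p \<noteq> seg G p"
    "e = {p, seg G p, side G p, seg G (side G p)}"
proof -
  obtain p where "p \<in> flags G - hr_flags G" "e = {p, seg G p, side G p, seg G (side G p)}"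
    using assms unfolding edges_def by blast
  then show ?thesis by (intro that[of p]) (simp_all add: hr_flags_def)
qed

text \<open>Since \<open>seg\<close> and \<open>side\<close> commute, they generate the same
  four-element set from each of its flags, so any flag of an edge can serve as its
  representative.\<close>

lemma edge_of_flag:
  assumes "e \<in> edges G" "p \<in> e"
  shows "p \<in> flags G" "side G p \<noteq> seg G p" "e = {p, seg G p, side G p, seg G (side G p)}"
proof -
  obtain x where x: "x \<in> flags G" "side G x \<noteq> seg G x"
      "e = {x, seg G x, side G x, seg G (side G x)}"
    using assms(1) by (rule edgeE)
  have s: "side G (seg G (side G x)) = seg G x" "seg G (seg G (side G x)) = side G x"
    using maps[OF x(1)] maps[of "side G x"] by auto
  note m = maps[OF x(1)] s
  have "p \<in> {x, seg G x, side G x, seg G (side G x)}" using assms(2) x(3) by simp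
  then consider "p = x" | "p = seg G x" | "p = side G x" | "p = seg G (side G x)" by blast
  then have "p \<in> flags G \<and> side G p \<noteq> seg G p \<and> e = {p, seg G p, side G p, seg G (side G p)}"
  proof cases
    case 1 with x show ?thesis by simp
  next
    case 2
    have "seg G (side G x) \<noteq> x" using s(2) x(2) by force
    with 2 show ?thesis unfolding x(3) using m by auto
  next
    case 3
    have "seg G (side G x) \<noteq> x" using s(2) x(2) by force
    with 3 show ?thesis unfolding x(3) using m by auto
  next
    case 4
    have "seg G (side G x) \<in> flags G" using maps[OF m(7)] by simp
    with 4 x(2) show ?thesis unfolding x(3) using m by auto
  qed
  then show "p \<in> flags G" "side G p \<noteq> seg G p" "e = {p, seg G p, side G p, seg G (side G p)}"
    by auto
qed

lemma Union_edges: "\<Union>(edges G) = flags G - hr_flags G"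
proof (intro equalityI subsetI)
  fix p assume "p \<in> \<Union>(edges G)"
  then show "p \<in> flags G - hr_flags G"
    using edge_of_flag by (auto simp: hr_flags_def)
next
  fix p assume "p \<in> flags G - hr_flags G"
  then show "p \<in> \<Union>(edges G)" unfolding edges_def by blast
qed

lemma edges_disjoint:
  assumes "e \<in> edges G" "e' \<in> edges G" "p \<in> e" "p \<in> e'"
  shows "e = e'"
  by (rule trans[OF edge_of_flag(3)[OF assms(1,3)] edge_of_flag(3)[OF assms(2,4), symmetric]])

lemma herg_cut: "X \<subseteq> edges G \<Longrightarrow> is_herg (cut G X)"
  using is_herg_cut herg by blast

lemma hr_flags_cut:
  assumes "X \<subseteq> edges G"
  shows "hr_flags (cut G X) = hr_flags G \<union> \<Union>X"
  using assms edge_of_flag(1) by (auto simp: hr_flags_def split: if_splits)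

lemma edges_cut:
  assumes "X \<subseteq> edges G"
  shows "edges (cut G X) = edges G - X"
proof -
  interpret C: half_edge_ribbon_graph "cut G X"
    by unfold_locales (rule herg_cut[OF assms])
  have closed: "e \<in> X \<longleftrightarrow> p \<in> \<Union>X" if "e \<in> edges G" "p \<in> e" for e p
    using that assms edges_disjoint by blast
  show ?thesis
  proof (intro equalityI subsetI)
    fix e assume e: "e \<in> edges (cut G X)"
    from e obtain p where p: "p \<in> flags G" "side (cut G X) p \<noteq> seg G p"
        "e = {p, seg G p, side (cut G X) p, seg G (side (cut G X) p)}"
      by (auto elim: C.edgeE simp del: cut_simps(5))
    from p(2) have np: "p \<notin> \<Union>X" by (metis cut_simps(5))
    then have "side (cut G X) p = side G p" by simp
    with p have e': "e = {p, seg G p, side G p, seg G (side G p)}" "side G p \<noteq> seg G p"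
      by simp_all
    with p(1) have "e \<in> edges G" by (auto simp: edges_def hr_flags_def)
    with np e' show "e \<in> edges G - X" by auto
  next
    fix e assume e: "e \<in> edges G - X"
    then obtain p where p: "p \<in> flags G" "side G p \<noteq> seg G p"
        "e = {p, seg G p, side G p, seg G (side G p)}" by (auto elim: edgeE)
    with e closed[of e p] have "p \<notin> \<Union>X" by blast
    then have "side (cut G X) p = side G p" by simp
    with p show "e \<in> edges (cut G X)" unfolding edges_def hr_flags_def
      by (auto simp del: cut_simps(5))
  qed
qed

text \<open>The set \<open>X\<close> can be read off as the edges that are missing after the cut.
  This turns sums over cut subgraphs into sums over edge subsets.\<close>

lemma inj_on_cut: "inj_on (cut G) (Pow (edges G))"
proof (rule inj_onI)
  fix X Y assume XY: "X \<in> Pow (edges G)" "Y \<in> Pow (edges G)" "cut G X = cut G Y"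
  have "edges G - X = edges G - Y"
    using XY edges_cut[of X] edges_cut[of Y] by simp
  with XY show "X = Y" by blast
qed

lemma vertices_cut: "vertices (cut G X) = vertices G"
  by (simp add: vertices_def)

text \<open>Orbits of \<open>side\<close> and \<open>arc\<close> are either closed or external, and
  each bare disc adds one closed face.\<close>

lemma card_boundary: "f_int G + C_ext G = card (boundary G) + card (bare G)"
proof -
  have fin: "finite (boundary G)"
    using finite_orbits[OF finite_flags] by (simp add: boundary_def)
  have "boundary G = {B \<in> boundary G. B \<inter> hr_flags G = {}} \<union> external_cycles G"
    by (auto simp: external_cycles_def boundary_def)
  also have "card \<dots> = card {B \<in> boundary G. B \<inter> hr_flags G = {}} + card (external_cycles G)"
    by (rule card_Un_disjoint) (use fin in \<open>auto simp: external_cycles_def boundary_def\<close>)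
  finally show ?thesis
    using fin finite_bare
    by (simp add: f_int_def C_ext_def closed_faces_def card_Plus boundary_def)
qed

lemma C_ext_eq_0_iff: "C_ext G = 0 \<longleftrightarrow> hr_flags G = {}"
proof
  assume "C_ext G = 0"
  moreover have "finite (external_cycles G)"
    using finite_orbits[OF finite_flags] by (simp add: external_cycles_def)
  ultimately have "external_cycles G = {}" by (simp add: C_ext_def)
  then have E: "B \<inter> hr_flags G = {}" if "B \<in> orbits (flags G) {side G, arc G}" for B
    using that by (auto simp: external_cycles_def)
  show "hr_flags G = {}"
  proof (rule equals0I)
    fix p assume p: "p \<in> hr_flags G"
    let ?B = "(flag_rel (flags G) {side G, arc G})\<^sup>* `` {p}"
    have "?B \<in> orbits (flags G) {side G, arc G}"
      using p unfolding orbits_flag_rel by (intro quotientI) (simp add: hr_flags_def)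
    from E[OF this] p show False by auto
  qed
qed (simp add: C_ext_def external_cycles_def)

section \<open>Connected components and the cut of a single edge\<close>

lemma sym_all: "sym (flag_rel (flags G) {seg G, arc G, side G})"
  by (rule sym_flag_rel) (use involution in auto)

lemma num_components_le_vertices: "num_components G \<le> card (vertices G)"
proof -
  have "flag_rel (flags G) {seg G, arc G} \<subseteq> flag_rel (flags G) {seg G, arc G, side G}"
    by (auto simp: flag_rel_def)
  from card_quotient_antimono[OF this sym_all finite_flags] show ?thesis
    using finite_bare finite_flags
    by (simp add: num_components_def components_def vertices_def card_Plus finite_orbits
        orbits_flag_rel[symmetric])
qed

lemma num_components_cut: "num_components G \<le> num_components (cut G X)"
proof -
  have "flag_rel (flags G) {seg G, arc G, side (cut G X)} \<subseteq> flag_rel (flags G) {seg G, arc G, side G}"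
    by (auto simp: flag_rel_def)
  from card_quotient_antimono[OF this sym_all finite_flags] show ?thesis
    using finite_bare finite_flags
    by (simp add: num_components_def components_def card_Plus finite_orbits
        orbits_flag_rel[symmetric] del: cut_simps(5))
qed

text \<open>Equivalently, cutting an edge does not increase the Euler genus. If the number of
  components is unchanged, at most one boundary component is lost; if the edge is a bridge, at least
  one must be gained.\<close>

lemma cut_edge_boundary_components:
  assumes "e \<in> edges G"
  shows "card (boundary G) + 2 * num_components (cut G {e})
           \<le> card (boundary (cut G {e})) + 2 * num_components G + 1"
proof -
  obtain p where p: "p \<in> flags G" "side G p \<noteq> seg G p"
      "e = {p, seg G p, side G p, seg G (side G p)}"
    using assms by (rule edgeE)
  \<comment> \<open>The edge has attaching segments \<open>p p'\<close> and \<open>q q'\<close>, and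
    sides \<open>p q\<close> and \<open>p' q'\<close>. The boundary follows the sides before the cut
    and the segments after it.\<close>
  define p' where "p' = seg G p"
  define q where "q = side G p"
  define q' where "q' = seg G q"
  let ?P = "flags G"
  let ?G' = "cut G {e}"
  note m = maps[OF p(1), folded p'_def q_def]
  have q: "q \<in> ?P" and p': "p' \<in> ?P" using m by auto
  note mq = maps[OF q, folded q'_def]
  have q': "q' \<in> ?P" using mq by auto
  have e: "e = {p, p', q, q'}" by (simp add: p(3) p'_def q_def q'_def)
  have sub: "{p, q, p', q'} \<subseteq> ?P" using p q p' q' by simp
  have side_e: "side G p = q" "side G q = p" "side G p' = q'" "side G q' = p'"
    using m mq q' maps[OF q'] maps[OF p'] by (auto simp: q_def p'_def q'_def)
  have seg_e: "seg G p = p'" "seg G p' = p" "seg G q = q'" "seg G q' = q"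
    using m mq by (auto simp: p'_def q'_def)
  have side_off: "side G x \<in> ?P - e" if "x \<in> ?P - e" for x
  proof -
    have x: "side G (side G x) = x" "side G x \<in> ?P" using that maps(7,9) by blast+
    have "side G x \<notin> e"
    proof
      assume "side G x \<in> e"
      then have "side G (side G x) \<in> e" using side_e by (auto simp: e)
      with x that show False by simp
    qed
    with x show ?thesis by blast
  qed
  \<comment> \<open>The part of the boundary relation away from the edge, common to both
    graphs.\<close>
  define r where "r = flag_rel ?P {arc G} \<union> flag_rel (?P - e) {side G}"
  have "free_involution_on (?P - e) (side G)"
    unfolding free_involution_on_def using side_off maps(8,9) by blast
  then have symr: "sym r"
    unfolding r_def using involution(2) by (intro sym_Un sym_flag_rel) auto
  have b: "boundary G = ?P // (join p q (join p' q' r))\<^sup>*"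
  proof -
    have "flag_rel ?P {side G, arc G} = join p q (join p' q' r)"
      unfolding flag_rel_eq_Sigma r_def join_def using sub by (auto simp: e side_e)
    then show ?thesis by (simp add: boundary_def orbits_flag_rel)
  qed
  have b': "boundary ?G' = ?P // (join p p' (join q q' r))\<^sup>*"
  proof -
    have "flag_rel ?P {side ?G', arc G} = join p p' (join q q' r)"
      unfolding flag_rel_eq_Sigma r_def join_def using sub by (auto simp: e seg_e)
    then show ?thesis by (simp add: boundary_def orbits_flag_rel)
  qed
  define s where "s = flag_rel ?P {seg G, arc G, side ?G'}"
  have s: "s = flag_rel ?P {seg G, arc G} \<union> flag_rel (?P - e) {side G}"
    unfolding s_def flag_rel_eq_Sigma by (auto simp: e)
  interpret C: half_edge_ribbon_graph ?G'
    by unfold_locales (rule herg_cut, use assms in simp)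
  have syms: "sym s"
    using C.sym_all by (simp add: s_def del: cut_simps(5))
  have rs: "r \<subseteq> s" unfolding r_def s by (auto simp: flag_rel_def)
  have ss: "(p, p') \<in> s" "(p', p) \<in> s" "(q, q') \<in> s" "(q', q) \<in> s"
    unfolding s flag_rel_eq_Sigma using sub by (auto simp: seg_e)
  have kG': "num_components ?G' = card (?P // s\<^sup>*) + card (bare G)"
    unfolding num_components_def components_def s_def
    by (simp add: card_Plus finite_orbits finite_flags finite_bare orbits_flag_rel[symmetric]
        del: cut_simps(5))
  have kG: "num_components G = card (?P // (join p q s)\<^sup>*) + card (bare G)"
  proof -
    have "flag_rel ?P {seg G, arc G, side G} = join p q (join p' q' s)"
      unfolding s flag_rel_eq_Sigma join_def using sub by (auto simp: e side_e)
    \<comment> \<open>The attaching segments survive in \<open>s\<close>, so one side of the edge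
      already links all four flags and the other side adds nothing.\<close>
    moreover have "(join p q (join p' q' s))\<^sup>* = (join p q s)\<^sup>*"
    proof (rule rtrancl_subset)
      show "join p q s \<subseteq> join p q (join p' q' s)" by (auto simp: join_def)
      have "(p', q') \<in> (join p q s)\<^sup>*" "(q', p') \<in> (join p q s)\<^sup>*"
        using ss unfolding rtrancl_join by auto
      then show "join p q (join p' q' s) \<subseteq> (join p q s)\<^sup>*"
        by (auto simp: join_def[of p' q'] join_def[of p q])
    qed
    ultimately show ?thesis unfolding num_components_def components_def
      by (simp add: card_Plus finite_orbits finite_flags finite_bare)
        (simp add: orbits_flag_rel)
  qed
  have k: "num_components ?G' = num_components G + (if (p, q) \<in> s\<^sup>* then 0 else 1)"
    using card_quotient_join[OF syms finite_flags p(1) q] kG kG' by simp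
  show ?thesis
  proof (cases "(p, q) \<in> s\<^sup>*")
    case True
    with k card_quotient_recouple_le[OF symr finite_flags sub] b b' show ?thesis by simp
  next
    case False
    have sD: "(y, x) \<in> s\<^sup>*" if "(x, y) \<in> s\<^sup>*" for x y
      using that syms by (meson sym_rtrancl symD)
    have rP: "r \<subseteq> ?P \<times> ?P"
      using maps(4) side_off unfolding r_def flag_rel_eq_Sigma by blast
    have rs': "(x, y) \<in> s\<^sup>*" if "(x, y) \<in> r\<^sup>*" for x y
      using that rtrancl_mono[OF rs] by auto
    text \<open>A parity argument: otherwise \<open>arc\<close> would pair off the whole class of \<open>x\<close> and \<open>side\<close> all of
      it except \<open>x\<close>.\<close>
    have ends: "(x, x') \<in> r\<^sup>*" if x: "x \<in> e" and one: "e \<inter> r\<^sup>* `` {x} \<subseteq> {x, x'}" for x x'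
    proof (rule ccontr)
      assume n: "(x, x') \<notin> r\<^sup>*"
      let ?C = "r\<^sup>* `` {x}"
      have "?C \<subseteq> ?P"
      proof
        fix y assume "y \<in> ?C"
        then have "(x, y) \<in> r\<^sup>*" by simp
        then show "y \<in> ?P"
        proof induction
          case base
          show ?case using x sub by (auto simp: e)
        next
          case (step y z)
          with rP show ?case by blast
        qed
      qed
      then have fin: "finite ?C" using finite_flags finite_subset by blast
      have "arc G y \<in> ?C" if "y \<in> ?C" for y
      proof -
        have "(y, arc G y) \<in> r"
          using that \<open>?C \<subseteq> ?P\<close> by (auto simp: r_def flag_rel_eq_Sigma)
        with that show ?thesis by (auto intro: rtrancl_into_rtrancl)
      qed
      then have "free_involution_on ?C (arc G)"
        using \<open>?C \<subseteq> ?P\<close> maps(5,6) unfolding free_involution_on_def by blast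
      then have "even (card ?C)" using fin even_card_free_involution by blast
      have Ce: "?C - {x} = ?C - e" using one x n by blast
      have "side G y \<in> ?C - e" if "y \<in> ?C - e" for y
      proof -
        have y: "y \<in> ?P - e" using that \<open>?C \<subseteq> ?P\<close> by blast
        then have "(y, side G y) \<in> r" by (auto simp: r_def flag_rel_eq_Sigma)
        with that have "side G y \<in> ?C" by (auto intro: rtrancl_into_rtrancl)
        with side_off[OF y] show ?thesis by blast
      qed
      then have "free_involution_on (?C - {x}) (side G)"
        using \<open>?C \<subseteq> ?P\<close> maps(8,9) unfolding free_involution_on_def Ce by blast
      then have "even (card (?C - {x}))" using fin even_card_free_involution by blast
      moreover have "Suc (card (?C - {x})) = card ?C"
        by (rule card_Suc_Diff1[OF fin]) simp
      ultimately show False using \<open>even (card ?C)\<close> by (metis even_Suc)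
    qed
    have qp: "(q, p) \<notin> s\<^sup>*"
      using False sD by blast
    have pq': "(p, q') \<notin> s\<^sup>*"
      using False rtrancl_into_rtrancl[OF _ ss(4), of p] by (rule contrapos_nn)
    have qp': "(q, p') \<notin> s\<^sup>*"
      using qp rtrancl_into_rtrancl[OF _ ss(2), of q] by (rule contrapos_nn)
    \<comment> \<open>As \<open>r \<subseteq> s\<close>, boundary paths avoiding the edge stay
      within one component of the cut graph, and \<open>p\<close> and \<open>q\<close> now lie in
      different ones. Hence each class meets the edge only at its own attaching segment, which is
      what \<open>ends\<close> asks for.\<close>
    have "q \<notin> r\<^sup>* `` {p}" "q' \<notin> r\<^sup>* `` {p}"
      using False pq' rs'[of p q] rs'[of p q'] by auto
    then have e_p: "e \<inter> r\<^sup>* `` {p} \<subseteq> {p, p'}"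
      by (auto simp only: e)
    have "p \<notin> r\<^sup>* `` {q}" "p' \<notin> r\<^sup>* `` {q}"
      using qp qp' rs'[of q p] rs'[of q p'] by auto
    then have e_q: "e \<inter> r\<^sup>* `` {q} \<subseteq> {q, q'}"
      by (auto simp only: e)
    have "p \<in> e" "q \<in> e" by (simp_all add: e)
    from ends[OF this(1) e_p] ends[OF this(2) e_q]
    have "(p, p') \<in> r\<^sup>*" "(q, q') \<in> r\<^sup>*" by this
    moreover have "(p, q) \<notin> r\<^sup>*" using False rs' by blast
    ultimately show ?thesis
      using card_quotient_recouple_less[OF symr finite_flags sub] k False b b' by simp
  qed
qed

end

section \<open>Euler genus and the telescoped sum\<close>

text \<open>With all boundary components capped by discs, Euler's formula identifies the difference
  of the two sides with the Euler genus. Induction on the number of edges: a cut removes one edge,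
  keeps the vertices and does not increase this difference.\<close>

theorem Euler_genus_nonneg:
  assumes "is_herg G"
  shows "card (vertices G) + card (boundary G) + card (bare G) \<le> 2 * num_components G + card (edges G)"
  using assms
proof (induction "card (edges G)" arbitrary: G)
  case 0
  interpret half_edge_ribbon_graph G by unfold_locales fact
  have "edges G = {}" using 0 finite_edges by simp
  \<comment> \<open>Without edges \<open>side\<close> and \<open>seg\<close> agree on the flags, so
    vertices, boundary components and connected components correspond, and equality holds.\<close>
  then have "side G p = seg G p" if "p \<in> flags G" for p
    using that Union_edges by (auto simp: hr_flags_def)
  then have "boundary G = orbits (flags G) {seg G, arc G, side G}"
    "orbits (flags G) {seg G, arc G} = orbits (flags G) {seg G, arc G, side G}"
    unfolding boundary_def by (auto intro!: orbits_cong)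
  then show ?case
    using finite_flags finite_bare
    by (simp add: num_components_def components_def vertices_def card_Plus finite_orbits)
next
  case (Suc n)
  interpret half_edge_ribbon_graph G by unfold_locales fact
  obtain e where e: "e \<in> edges G" using Suc.hyps(2) by fastforce
  have "is_herg (cut G {e})" using e herg_cut by simp
  moreover have c: "card (edges (cut G {e})) = n"
    using e Suc.hyps(2) finite_edges by (simp add: edges_cut)
  ultimately have "card (vertices G) + card (boundary (cut G {e})) + card (bare G)
      \<le> 2 * num_components (cut G {e}) + n"
    using Suc.hyps(1)[of "cut G {e}"] by (simp add: vertices_cut)
  with cut_edge_boundary_components[OF e] Suc.hyps(2) show ?case by linarith
qed

text \<open>Cutting preserves the vertices, so the rank difference is \<open>k(A) - k(G)\<close>.
  The exponent of \<open>a\<close> is therefore \<open>k(A) - k(G) + n(A) - (k(A) + n(A) - f_int(A))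
  = f_int(A) - k(G)\<close>, and the factor \<open>a\<close> compensates for
  \<open>k(G) = 1\<close>.\<close>

lemma (in half_edge_ribbon_graph) times_R_poly:
  fixes a :: "'r::comm_ring_1"
  assumes "herg_connected G" and unit: "a * a' = 1"
  shows "a * R_poly G (a + 1) a a' b 1 1 =
    (\<Sum>X\<in>Pow (edges G). a ^ f_int (cut G X) * b ^ C_ext (cut G X))"
proof -
  have "a * R_poly G (a + 1) a a' b 1 1 =
      (\<Sum>X\<in>Pow (edges G). a * (a ^ (rank G - rank (cut G X)) * a ^ nullity (cut G X)
        * a' ^ (num_components (cut G X) + nullity (cut G X) - f_int (cut G X))
        * b ^ C_ext (cut G X)))"
  proof -
    have "spanning_cutting_subgraphs G = cut G ` Pow (edges G)"
      by (auto simp: spanning_cutting_subgraphs_def)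
    then show ?thesis
      by (simp add: R_poly_def sum_distrib_left sum.reindex[OF inj_on_cut])
  qed
  also have "\<dots> = (\<Sum>X\<in>Pow (edges G). a ^ f_int (cut G X) * b ^ C_ext (cut G X))"
  proof (rule sum.cong[OF refl])
    fix X assume "X \<in> Pow (edges G)"
    then interpret C: half_edge_ribbon_graph "cut G X"
      by unfold_locales (auto intro: herg_cut)
    let ?A = "cut G X"
    define m where "m = num_components ?A + nullity ?A - f_int ?A"
    \<comment> \<open>Nonnegative Euler genus enters here: it keeps the exponent of
      \<open>a'\<close> from being truncated.\<close>
    have "f_int ?A \<le> num_components ?A + nullity ?A"
      using Euler_genus_nonneg[OF C.herg] C.card_boundary C.num_components_le_vertices
      unfolding nullity_def rank_def by linarith
    then have "Suc (rank G - rank ?A + nullity ?A) = f_int ?A + m"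
      using assms(1) num_components_cut[of X] C.num_components_le_vertices
      unfolding m_def rank_def herg_connected_def vertices_cut by linarith
    then have "a * (a ^ (rank G - rank ?A) * a ^ nullity ?A) = a ^ f_int ?A * a ^ m"
      by (simp only: power_add[symmetric] power_Suc[symmetric])
    then have "a * (a ^ (rank G - rank ?A) * a ^ nullity ?A * a' ^ m * b ^ C_ext ?A)
        = a ^ f_int ?A * (a ^ m * a' ^ m) * b ^ C_ext ?A"
      by (simp only: mult.assoc[symmetric])
    moreover have "a ^ m * a' ^ m = 1"
      by (simp only: power_mult_distrib[symmetric] unit power_one)
    ultimately show "a * (a ^ (rank G - rank ?A) * a ^ nullity ?A
        * a' ^ (num_components ?A + nullity ?A - f_int ?A) * b ^ C_ext ?A)
        = a ^ f_int ?A * b ^ C_ext ?A"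
      by (simp only: m_def[symmetric] mult_1_right)
  qed
  finally show ?thesis .
qed

section \<open>The dual as an exchange of \<open>seg\<close> and \<open>side\<close>\<close>

context half_edge_ribbon_graph
begin

text \<open>At a half-ribbon, the walk defining \<open>merged\<close> runs from
  \<open>(p, False)\<close> through \<open>(p, True)\<close> and \<open>(seg G p, True)\<close> to
  \<open>(seg G p, False)\<close>. The merged segment thus has the ends \<open>p\<close> and
  \<open>seg G p\<close>, and since \<open>seg\<close> and \<open>side\<close> agree there, the
  exchange is uniform over all ribbons.\<close>

lemma dual_simps [simp]:
  "flags (dual G) = flags G" "arc (dual G) = arc G" "bare (dual G) = bare G"
  "seg (dual G) = side G" "side (dual G) = seg G"
proof -
  have hr: "side G p = seg G p" "seg G p \<in> hr_flags G" if "p \<in> hr_flags G" for p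
  proof -
    have p: "p \<in> flags G" and eq: "side G p = seg G p"
      using that by (simp_all add: hr_flags_def)
    show "side G p = seg G p" by (rule eq)
    show "seg G p \<in> hr_flags G"
      using maps(10)[OF p] by (simp add: hr_flags_def maps(1)[OF p] eq)
  qed
  have "(p, False) \<in> flags (geometric_dual (completion G)) \<longleftrightarrow> p \<in> flags G" for p
    by (simp add: geometric_dual_def completion_def image_iff)
  then show "flags (dual G) = flags G" by (simp add: dual_def Let_def)
  show "arc (dual G) = arc G" "bare (dual G) = bare G"
    by (simp_all add: dual_def Let_def geometric_dual_def completion_def)
  have "seg (dual G) p = side G p \<and> side (dual G) p = seg G p" for p
  proof (cases "p \<in> hr_flags G")
    case True
    from hr[OF this] True show ?thesis
      by (simp add: dual_def Let_def geometric_dual_def completion_def)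
  next
    case False
    then show ?thesis
      by (simp add: dual_def Let_def geometric_dual_def completion_def)
  qed
  then show "seg (dual G) = side G" "side (dual G) = seg G" by (simp_all add: fun_eq_iff)
qed

lemma hr_flags_dual [simp]: "hr_flags (dual G) = hr_flags G"
  by (auto simp: hr_flags_def)

lemma num_components_dual [simp]: "num_components (dual G) = num_components G"
  by (simp add: num_components_def components_def insert_commute)

lemma edges_dual: "edges (dual G) = edges G"
proof -
  have "{p, side G p, seg G p, side G (seg G p)} = {p, seg G p, side G p, seg G (side G p)}"
    if "p \<in> flags G" for p
    by (simp add: maps(10)[OF that] insert_commute)
  then show ?thesis
    unfolding edges_def hr_flags_dual Setcompr_eq_image dual_simps by (intro image_cong) simp_all
qed

text \<open>On flags of \<open>X\<close> both boundaries follow \<open>seg G\<close>, on flags of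
  the other edges both follow \<open>side G\<close>, and at half-ribbons the two maps coincide;
  \<open>arc\<close> is shared.\<close>

lemma boundary_cut_dual:
  assumes "X \<subseteq> edges G"
  shows "boundary (cut (dual G) (edges G - X)) = boundary (cut G X)"
proof -
  have "side (cut (dual G) (edges G - X)) p = side (cut G X) p" if "p \<in> flags G" for p
  proof (cases "p \<in> hr_flags G")
    case True
    then show ?thesis by (auto simp: hr_flags_def)
  next
    case False
    with that have "p \<in> \<Union>(edges G)" by (simp add: Union_edges)
    then obtain e where e: "e \<in> edges G" "p \<in> e" by blast
    then have "e' = e" if "e' \<in> edges G" "p \<in> e'" for e'
      using that edges_disjoint by simp
    with e assms have "p \<in> \<Union>(edges G - X) \<longleftrightarrow> e \<notin> X" "p \<in> \<Union>X \<longleftrightarrow> e \<in> X"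
      by (blast, blast)
    then have "p \<in> \<Union>(edges G - X) \<longleftrightarrow> p \<notin> \<Union>X"
      by blast
    then show ?thesis by simp
  qed
  then show ?thesis unfolding boundary_def by (auto intro!: orbits_cong simp del: cut_simps(5))
qed

end

section \<open>Duality modulo \<open>b\<^sup>2 = a b\<close>\<close>

lemma eq_mod_refl: "eq_mod u u"
  by (simp add: eq_mod_def)

lemma eq_mod_sym: "eq_mod u v \<Longrightarrow> eq_mod v u"
  unfolding eq_mod_def by (subst minus_diff_eq[symmetric]) (simp only: dvd_minus_iff)

lemma eq_mod_trans:
  assumes "eq_mod u v" "eq_mod v w"
  shows "eq_mod u w"
proof -
  have "(u - v) + (v - w) = u - w" by simp
  with dvd_add[OF assms[unfolded eq_mod_def]] show ?thesis by (simp only: eq_mod_def)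
qed

lemma eq_mod_mult_left: "eq_mod u v \<Longrightarrow> eq_mod (c * u) (c * v)"
  unfolding eq_mod_def right_diff_distrib[symmetric] by (rule dvd_mult)

lemma eq_mod_sum: "(\<And>x. x \<in> A \<Longrightarrow> eq_mod (f x) (g x)) \<Longrightarrow> eq_mod (sum f A) (sum g A)"
  unfolding eq_mod_def sum_subtractf[symmetric] by (rule dvd_sum)

lemma eq_mod_power_b: "eq_mod (var_b ^ Suc n) (var_a ^ n * var_b)"
proof (induction n)
  case 0
  show ?case by (simp add: eq_mod_refl)
next
  case (Suc n)
  have 1: "eq_mod (var_b ^ Suc (Suc n)) (var_a ^ n * var_b\<^sup>2)"
    using eq_mod_mult_left[OF Suc.IH, of var_b] by (simp add: power2_eq_square mult_ac)
  have 2: "eq_mod (var_a ^ n * var_b\<^sup>2) (var_a ^ n * (var_a * var_b))"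
    by (rule eq_mod_mult_left) (simp add: eq_mod_def)
  from eq_mod_trans[OF 1 2] show ?case by (simp add: mult_ac)
qed

text \<open>Trading every \<open>b\<close> but one for an \<open>a\<close> brings both monomials to
  the form \<open>a ^ (i + m - 1) * b\<close>. Positivity of \<open>m\<close> and \<open>n\<close>
  provides the \<open>b\<close> that is kept.\<close>

lemma eq_mod_monomials:
  assumes "i + m = j + n" "m > 0" "n > 0"
  shows "eq_mod (var_a ^ i * var_b ^ m) (var_a ^ j * var_b ^ n)"
proof -
  have *: "eq_mod (var_a ^ i * var_b ^ m) (var_a ^ (i + m - 1) * var_b)" if "m > 0" for i m
    using eq_mod_mult_left[OF eq_mod_power_b[of "m - 1"], of "var_a ^ i"] that
    by (simp add: power_add[symmetric] mult.assoc[symmetric])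
  show ?thesis
    by (rule eq_mod_trans[OF *[OF assms(2)]]) (simp only: assms(1) eq_mod_sym[OF *[OF assms(3)]])
qed

section \<open>Matching complementary edge subsets\<close>

context half_edge_ribbon_graph
begin

abbreviation face_monomial :: "('p, 'v) herg \<Rightarrow> coeff_ring" where
  "face_monomial A \<equiv> var_a ^ f_int A * var_b ^ C_ext A"

text \<open>The two cut graphs have the same total number of boundary components, so it remains to
  find a half-ribbon in each. If \<open>G\<close> has none, cutting supplies one on the left when
  \<open>X\<close> is nonempty and on the right when its complement is.\<close>

lemma face_monomial_cut_dual:
  assumes "X \<subseteq> edges G" "hr_flags G = {} \<longrightarrow> X \<noteq> {} \<and> X \<noteq> edges G"
  shows "eq_mod (face_monomial (cut G X)) (face_monomial (cut (dual G) (edges G - X)))"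
proof -
  interpret D: half_edge_ribbon_graph "dual G"
    by unfold_locales (rule is_herg_dual[OF herg])
  interpret C: half_edge_ribbon_graph "cut G X"
    by unfold_locales (rule herg_cut[OF assms(1)])
  interpret C': half_edge_ribbon_graph "cut (dual G) (edges G - X)"
    by unfold_locales (rule D.herg_cut, simp add: edges_dual)
  have ne: "Y = {} \<longleftrightarrow> \<Union>Y = {}" if "Y \<subseteq> edges G" for Y
  proof -
    have "e \<noteq> {}" if "e \<in> edges G" for e
      using that by (rule edgeE) simp
    with that show ?thesis by blast
  qed
  have "C_ext (cut G X) \<noteq> 0"
    using assms ne[of X] unfolding C.C_ext_eq_0_iff hr_flags_cut[OF assms(1)] by auto
  moreover have "hr_flags (cut (dual G) (edges G - X)) = hr_flags G \<union> \<Union>(edges G - X)"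
    using D.hr_flags_cut[of "edges G - X"] by (simp add: edges_dual)
  then have "C_ext (cut (dual G) (edges G - X)) \<noteq> 0"
    using assms ne[of "edges G - X"] unfolding C'.C_ext_eq_0_iff by blast
  ultimately show ?thesis
    using C.card_boundary C'.card_boundary boundary_cut_dual[OF assms(1)]
    by (intro eq_mod_monomials) auto
qed

text \<open>Complementation permutes \<open>S\<close>. Both the full power set and the power set
  without its two extreme members are of this kind, one for each part of the theorem.\<close>

lemma sum_face_monomials_dual:
  assumes "S \<subseteq> Pow (edges G)" "\<And>X. X \<in> S \<Longrightarrow> edges G - X \<in> S"
    and "hr_flags G = {} \<Longrightarrow> {} \<notin> S" "hr_flags G = {} \<Longrightarrow> edges G \<notin> S"
  shows "eq_mod (\<Sum>X\<in>S. face_monomial (cut G X)) (\<Sum>X\<in>S. face_monomial (cut (dual G) X))"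
proof -
  have "(\<Sum>X\<in>S. face_monomial (cut (dual G) X)) =
      (\<Sum>X\<in>S. face_monomial (cut (dual G) (edges G - X)))"
    by (rule sum.reindex_bij_witness[where i = "\<lambda>X. edges G - X" and j = "\<lambda>X. edges G - X"])
      (use assms in \<open>auto simp: double_diff\<close>)
  also have "eq_mod (\<Sum>X\<in>S. face_monomial (cut G X)) \<dots>"
    by (intro eq_mod_sum face_monomial_cut_dual) (use assms in auto)
  finally show ?thesis .
qed

text \<open>The two graphs in \<open>M_poly\<close> are the cuts along \<open>edges G\<close> and
  \<open>{}\<close>. If there are no edges these coincide, and both sets then contain a single
  element.\<close>

lemma times_R_poly_minus_M_poly:
  assumes "herg_connected G"
  shows "var_a * R_poly G (var_a + 1) var_a var_a_inv var_b 1 1 - M_poly G var_a var_b =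
    (\<Sum>X\<in>Pow (edges G) - {{}, edges G}. face_monomial (cut G X))"
proof -
  have "cut G {} = G" by (simp add: cut_def)
  then have "{cut G (edges G), G} = cut G ` {{}, edges G}" by auto
  moreover have "inj_on (cut G) {{}, edges G}"
    by (rule inj_on_subset[OF inj_on_cut]) auto
  ultimately have "M_poly G var_a var_b = (\<Sum>X\<in>{{}, edges G}. face_monomial (cut G X))"
    unfolding M_poly_def by (simp only: sum.reindex comp_def)
  then show ?thesis
    unfolding times_R_poly[OF assms var_a_inv]
    by (subst sum_diff) (use finite_edges in auto)
qed

end

theorem theorem5:
  fixes G :: "('p, 'v) herg"
  assumes "is_herg G" and "herg_connected G"
  shows "(C_ext G > 0 \<longrightarrow>
            eq_mod (R_poly G (var_a + 1) var_a var_a_inv var_b 1 1)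
                   (R_poly (dual G) (var_a + 1) var_a var_a_inv var_b 1 1)) \<and>
         (C_ext G = 0 \<longrightarrow>
            eq_mod (var_a * R_poly G (var_a + 1) var_a var_a_inv var_b 1 1
                      - M_poly G var_a var_b)
                   (var_a * R_poly (dual G) (var_a + 1) var_a var_a_inv var_b 1 1
                      - M_poly (dual G) var_a var_b))"
proof -
  interpret half_edge_ribbon_graph G by unfold_locales fact
  interpret D: half_edge_ribbon_graph "dual G"
    by unfold_locales (rule is_herg_dual[OF herg])
  have conn: "herg_connected (dual G)"
    using assms(2) by (simp add: herg_connected_def)
  let ?R = "\<lambda>G :: ('p, 'v) herg. R_poly G (var_a + 1) var_a var_a_inv var_b 1 1"
  have R: "eq_mod (?R G) (?R (dual G))" if "C_ext G > 0"
  proof -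
    have "hr_flags G \<noteq> {}" using that C_ext_eq_0_iff by simp
    then have "eq_mod (var_a * ?R G) (var_a * ?R (dual G))"
      unfolding times_R_poly[OF assms(2) var_a_inv] D.times_R_poly[OF conn var_a_inv] edges_dual
      by (intro sum_face_monomials_dual) auto
    \<comment> \<open>The factor \<open>a\<close> is a unit, so the congruence can be divided by
      it.\<close>
    moreover have "var_a_inv * (var_a * u) = u" for u
      by (simp only: mult.assoc[symmetric] mult.commute[of var_a_inv] var_a_inv mult_1_left)
    ultimately show ?thesis
      using eq_mod_mult_left[of "var_a * ?R G" "var_a * ?R (dual G)" var_a_inv] by (simp only:)
  qed
  have M: "eq_mod (var_a * ?R G - M_poly G var_a var_b)
      (var_a * ?R (dual G) - M_poly (dual G) var_a var_b)"
    unfolding times_R_poly_minus_M_poly[OF assms(2)] D.times_R_poly_minus_M_poly[OF conn] edges_dual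
    by (intro sum_face_monomials_dual) auto
  show ?thesis by (intro conjI impI) (rule R, assumption, rule M)
qed

end
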